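(* Let $K_1, \ldots, K_n \subset \mathbb{R}^d$ be convex bodies containing the origin in their interior. For each $i \in \{1,\ldots,n\}$, let $V_i \subset S^{d-1}$ be a set of unit vectors with $0 \in \operatorname{conv} V_i$, and let $U_i$ be the set of orthogonal projections of $0$ onto the supporting hyperplanes of $K_i$ with outer normal directions in $V_i$. Then the family $\operatorname{int} K_1, \ldots, \operatorname{int} K_n$ does not permit a translative covering of the Minkowski sum $U_1 + \cdots + U_n$; that is, there are no $x_1, \ldots, x_n \in \mathbb{R}^d$ such that $$U_1 + \cdots + U_n \subset \bigcup_{i=1}^n (\operatorname{int} K_i + x_i).$$
   Context: A convex body is a compact convex set with nonempty interior. $S^{d-1}$ is the Euclidean unit sphere in $\mathbb{R}^d$. The supporting hyperplane of $K_i$ corresponding to the direction $v \in V_i$ is $\{x \in \mathbb{R}^d : \langle x, v\rangle = h_{K_i}(v)\}$, where $h_{K_i}(v) = \max_{y \in K_i} \langle y, v \rangle$; thus $U_i = \{h_{K_i}(v)\, v : v \in V_i\}$. $U_1 + \cdots + U_n = \{u_1 + \cdots + u_n : u_i \in U_i\}$. *)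

theory Defs
  imports "HOL-Analysis.Analysis" "HOL-Library.Set_Algebras"
begin

definition convex_body :: "'a::euclidean_space set \<Rightarrow> bool" where
  "convex_body K \<longleftrightarrow> compact K \<and> convex K \<and> interior K \<noteq> {}"

(* The supremum is a maximum when K is compact and nonempty, see support_fun_attained. *)
definition support_fun :: "'a::euclidean_space set \<Rightarrow> 'a \<Rightarrow> real" where
  "support_fun K v = (SUP y\<in>K. y \<bullet> v)"

definition supporting_hyperplane :: "'a::euclidean_space set \<Rightarrow> 'a \<Rightarrow> 'a set" where
  "supporting_hyperplane K v = {x. x \<bullet> v = support_fun K v}"

definition is_orthogonal_projection ::
    "'a::euclidean_space set \<Rightarrow> 'a \<Rightarrow> 'a \<Rightarrow> bool" where
  "is_orthogonal_projection H x p \<longleftrightarrow> p \<in> H \<and> (\<forall>y\<in>H. orthogonal (x - p) (y - p))"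

definition origin_projections :: "'a::euclidean_space set \<Rightarrow> 'a set \<Rightarrow> 'a set" where
  "origin_projections K V =
     {p. \<exists>v\<in>V. is_orthogonal_projection (supporting_hyperplane K v) 0 p}"

lemma support_fun_attained:
  assumes "compact K" "K \<noteq> {}"
  shows "\<exists>y\<in>K. y \<bullet> v = support_fun K v \<and> (\<forall>z\<in>K. z \<bullet> v \<le> y \<bullet> v)"
proof -
  have "continuous_on K (\<lambda>y. y \<bullet> v)"
    by (intro continuous_intros)
  then obtain y where y: "y \<in> K" "\<forall>z\<in>K. z \<bullet> v \<le> y \<bullet> v"
    using continuous_attains_sup[OF assms] by blast
  then have "support_fun K v = y \<bullet> v"
    unfolding support_fun_def by (intro cSup_eq_maximum) auto
  with y show ?thesis by auto
qed

lemma is_orthogonal_projection_supporting_hyperplane_iff: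
  assumes "norm v = 1"
  shows "is_orthogonal_projection (supporting_hyperplane K v) 0 p
           \<longleftrightarrow> p = support_fun K v *\<^sub>R v"
proof -
  have vv: "v \<bullet> v = 1"
    using assms by (simp add: norm_eq_1)
  let ?q = "support_fun K v *\<^sub>R v"
  show ?thesis
  proof
    assume p: "is_orthogonal_projection (supporting_hyperplane K v) 0 p"
    then have pv: "p \<bullet> v = support_fun K v"
      by (simp add: is_orthogonal_projection_def supporting_hyperplane_def)
    have "?q \<in> supporting_hyperplane K v"
      by (simp add: supporting_hyperplane_def vv)
    with p have "p \<bullet> (?q - p) = 0"
      by (auto simp: is_orthogonal_projection_def orthogonal_def)
    then have "(?q - p) \<bullet> (?q - p) = support_fun K v * (v \<bullet> (?q - p))"
      by (simp add: inner_diff_left)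
    also have "\<dots> = 0"
      using pv by (simp add: inner_diff_right vv inner_commute)
    finally show "p = ?q" by simp
  next
    assume "p = ?q"
    then show "is_orthogonal_projection (supporting_hyperplane K v) 0 p"
      by (auto simp: is_orthogonal_projection_def supporting_hyperplane_def orthogonal_def
          vv inner_diff_right inner_commute)
  qed
qed

lemma origin_projections_eq:
  assumes "V \<subseteq> sphere 0 1"
  shows "origin_projections K V = (\<lambda>v. support_fun K v *\<^sub>R v) ` V"
  using assms is_orthogonal_projection_supporting_hyperplane_iff
  by (fastforce simp: origin_projections_def)

end

(* Given translations x, look for u in the product of the U i with
   u i \<bullet> ((\<Sum>j\<noteq>i. u j) - x i) \<ge> 0 for all i. Since u i is a positive multiple of v i \<in> V i
   with u i \<bullet> v i = h (v i), this says that (\<Sum>j. u j) - x i lies on or beyond the supporting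
   hyperplane of K i in direction v i, so the point \<Sum>j. u j is covered by no translate.
   Such a u maximises (\<Sum>i<j. u i \<bullet> u j) - (\<Sum>i. x i \<bullet> u i), which is affine in each u i separately:
   u i then maximises the linear functional with normal (\<Sum>j\<noteq>i. u j) - x i over U i, and this
   maximum is nonnegative because 0 is in the convex hull of U i. By Caratheodory's theorem the
   V i may be replaced by finite sets, so that the maximum exists. *)

theory Submission
  imports Defs
begin

text \<open>Otherwise \<open>S\<close> would lie in the open halfspace of negative inner product
  with \<open>w\<close>, which is convex and misses 0.\<close>

lemma convex_hull_zero_nonneg_inner:
  fixes w :: "'a::real_inner"
  assumes "0 \<in> convex hull S"
  obtains v where "v \<in> S" "v \<bullet> w \<ge> 0"
proof (rule ccontr)
  assume "\<not> thesis"
  with that have "S \<subseteq> {v. w \<bullet> v < 0}"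
    by (force simp: inner_commute)
  then have "convex hull S \<subseteq> {v. w \<bullet> v < 0}"
    by (intro hull_minimal convex_halfspace_lt)
  with assms show False
    by auto
qed

text \<open>From an interior point one can still move a short way along \<open>v\<close> inside
  \<open>K\<close>, which strictly increases the inner product with \<open>v\<close>.\<close>

lemma interior_inner_less_support_fun:
  assumes "compact K" "y \<in> interior K" "v \<noteq> 0"
  shows "y \<bullet> v < support_fun K v"
proof -
  obtain e where e: "e > 0" "cball y e \<subseteq> K"
    using assms(2) by (meson mem_interior_cball)
  have "y + (e / norm v) *\<^sub>R v \<in> K"
    using e assms(3) by (intro subsetD[OF e(2)]) (simp add: dist_norm)
  then have "(y + (e / norm v) *\<^sub>R v) \<bullet> v \<le> support_fun K v"
    using support_fun_attained[OF assms(1), of v] by fastforce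
  moreover have "(e / norm v) * (v \<bullet> v) > 0"
    using e assms(3) by simp
  ultimately show ?thesis
    by (simp add: inner_add_left)
qed

lemma exists_nonneg_inner_selection:
  fixes S :: "'i \<Rightarrow> 'a::real_inner set" and x :: "'i \<Rightarrow> 'a"
  assumes "finite I" "\<And>i. i \<in> I \<Longrightarrow> finite (S i)"
    and nonneg: "\<And>i w. i \<in> I \<Longrightarrow> \<exists>u\<in>S i. u \<bullet> w \<ge> 0"
  shows "\<exists>u\<in>PiE I S. \<forall>i\<in>I. u i \<bullet> (sum u (I - {i}) - x i) \<ge> 0"
proof -
  (* Twice the pairwise inner products of distinct u i, minus twice the linear part. *)
  define \<Phi> where "\<Phi> u = sum u I \<bullet> sum u I - (\<Sum>i\<in>I. u i \<bullet> u i) - 2 * (\<Sum>i\<in>I. x i \<bullet> u i)"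
    for u :: "'i \<Rightarrow> 'a"
  \<comment> \<open>The second summand does not involve \<open>u i\<close>, so a change of
    \<open>u\<close> at \<open>i\<close> alone affects only the first, which is linear in
    \<open>u i\<close>.\<close>
  have \<Phi>_split: "\<Phi> u = 2 * (u i \<bullet> (sum u (I - {i}) - x i)) + (sum u (I - {i}) \<bullet> sum u (I - {i})
      - (\<Sum>j\<in>I - {i}. u j \<bullet> u j) - 2 * (\<Sum>j\<in>I - {i}. x j \<bullet> u j))" if "i \<in> I" for u i
  proof -
    have "sum g I = g i + sum g (I - {i})" for g :: "'i \<Rightarrow> 'a"
      using assms(1) that by (rule sum.remove)
    moreover have "sum g I = g i + sum g (I - {i})" for g :: "'i \<Rightarrow> real"
      using assms(1) that by (rule sum.remove)
    ultimately show ?thesis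
      unfolding \<Phi>_def
      by (simp add: inner_add_left inner_add_right inner_diff_right
          inner_commute[of "sum u (I - {i})" "u i"] inner_commute[of "x i" "u i"])
  qed
  have "finite (PiE I S)"
    using assms by (intro finite_PiE)
  moreover have "PiE I S \<noteq> {}"
    using nonneg by (fastforce simp: PiE_eq_empty_iff)
  ultimately obtain u where u: "u \<in> PiE I S" "\<And>u'. u' \<in> PiE I S \<Longrightarrow> - \<Phi> u \<le> - \<Phi> u'"
    using arg_min_if_finite[of "PiE I S" "\<lambda>u. - \<Phi> u"] by (meson not_le)
  have "u i \<bullet> (sum u (I - {i}) - x i) \<ge> 0" if i: "i \<in> I" for i
  proof -
    obtain a where a: "a \<in> S i" "a \<bullet> (sum u (I - {i}) - x i) \<ge> 0"
      using nonneg i by blast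
    \<comment> \<open>Exchanging only the \<open>i\<close>-th choice for \<open>a\<close> cannot
      increase \<Phi>, so \<open>u i\<close> does at least as well as \<open>a\<close> in the linear
      term.\<close>
    define u' where "u' = u(i := a)"
    have "u' \<in> PiE I S"
      using u(1) a(1) i by (auto simp: u'_def PiE_iff extensional_def)
    then have "\<Phi> u' \<le> \<Phi> u"
      using u(2) by simp
    moreover have "sum u' (I - {i}) = sum u (I - {i})"
      "(\<Sum>j\<in>I - {i}. u' j \<bullet> u' j) = (\<Sum>j\<in>I - {i}. u j \<bullet> u j)"
      "(\<Sum>j\<in>I - {i}. x j \<bullet> u' j) = (\<Sum>j\<in>I - {i}. x j \<bullet> u j)" "u' i = a"
      by (auto simp: u'_def intro!: sum.cong)
    ultimately have "a \<bullet> (sum u (I - {i}) - x i) \<le> u i \<bullet> (sum u (I - {i}) - x i)"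
      unfolding \<Phi>_split[OF i] by simp
    with a(2) show ?thesis
      by simp
  qed
  with u(1) show ?thesis
    by blast
qed

theorem proposition2:
  fixes n :: nat
    and K V :: "nat \<Rightarrow> (real ^ 'd) set"
  assumes "\<And>i. i \<in> {1..n} \<Longrightarrow> convex_body (K i)"
    and "\<And>i. i \<in> {1..n} \<Longrightarrow> 0 \<in> interior (K i)"
    and "\<And>i. i \<in> {1..n} \<Longrightarrow> V i \<subseteq> sphere 0 1"
    and "\<And>i. i \<in> {1..n} \<Longrightarrow> 0 \<in> convex hull (V i)"
  shows "\<nexists>x :: nat \<Rightarrow> real ^ 'd.
           (\<Sum>i\<in>{1..n}. origin_projections (K i) (V i))
             \<subseteq> (\<Union>i\<in>{1..n}. (\<lambda>y. y + x i) ` interior (K i))"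
proof (intro notI, elim exE)
  fix x :: "nat \<Rightarrow> real ^ 'd"
  assume cover: "(\<Sum>i\<in>{1..n}. origin_projections (K i) (V i))
    \<subseteq> (\<Union>i\<in>{1..n}. (\<lambda>y. y + x i) ` interior (K i))"
  have "\<exists>W. finite W \<and> W \<subseteq> V i \<and> 0 \<in> convex hull W" if "i \<in> {1..n}" for i
    using assms(4)[OF that] caratheodory[of "V i"] by blast
  then obtain W where W: "\<And>i. i \<in> {1..n} \<Longrightarrow> finite (W i)" "\<And>i. i \<in> {1..n} \<Longrightarrow> W i \<subseteq> V i"
    "\<And>i. i \<in> {1..n} \<Longrightarrow> 0 \<in> convex hull (W i)"
    by metis
  have less_h: "y \<bullet> v < support_fun (K i) v"
    if "i \<in> {1..n}" "v \<in> V i" "y \<in> interior (K i)" for i v y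
    using that assms(1,3)[OF that(1)]
    by (intro interior_inner_less_support_fun) (auto simp: convex_body_def)
  \<comment> \<open>This is \<open>less_h\<close> at the interior point 0. Positivity lets signs of
    inner products pass between \<open>v\<close> and its multiple in \<open>S i\<close>.\<close>
  have h_pos: "support_fun (K i) v > 0" if "i \<in> {1..n}" "v \<in> V i" for i v
    using less_h[OF that assms(2)] that(1) by simp
  define S where "S i = (\<lambda>v. support_fun (K i) v *\<^sub>R v) ` W i" for i
  have nonneg: "\<exists>u\<in>S i. u \<bullet> w \<ge> 0" if i: "i \<in> {1..n}" for i w
  proof -
    obtain v where v: "v \<in> W i" "v \<bullet> w \<ge> 0"
      using convex_hull_zero_nonneg_inner W(3)[OF i] by blast
    then have "(support_fun (K i) v *\<^sub>R v) \<bullet> w \<ge> 0"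
      using h_pos[OF i, of v] W(2)[OF i] by (auto intro: mult_nonneg_nonneg less_imp_le)
    with v(1) show ?thesis
      unfolding S_def by blast
  qed
  have finite_S: "finite (S i)" if "i \<in> {1..n}" for i
    using W(1) that by (simp add: S_def)
  obtain u where "u \<in> PiE {1..n} S"
    and u_nonneg: "\<forall>i\<in>{1..n}. u i \<bullet> (sum u ({1..n} - {i}) - x i) \<ge> 0"
    using exists_nonneg_inner_selection[of "{1..n}" S x, OF finite_atLeastAtMost finite_S nonneg]
    by blast
  then have u_S: "u i \<in> S i" if "i \<in> {1..n}" for i
    using that by blast
  have "u i \<in> origin_projections (K i) (V i)" if "i \<in> {1..n}" for i
    using u_S[OF that] W(2)[OF that]
    by (auto simp: S_def origin_projections_eq[OF assms(3)[OF that]])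
  then have "sum u {1..n} \<in> (\<Sum>i\<in>{1..n}. origin_projections (K i) (V i))"
    by (auto simp: set_sum_alt)
  with cover obtain i where i: "i \<in> {1..n}" and "sum u {1..n} \<in> (\<lambda>y. y + x i) ` interior (K i)"
    by blast
  then have int: "sum u {1..n} - x i \<in> interior (K i)"
    by auto
  obtain v where v: "v \<in> V i" "u i = support_fun (K i) v *\<^sub>R v"
    using u_S[OF i] W(2)[OF i] by (auto simp: S_def)
  have "v \<bullet> v = 1"
    using assms(3)[OF i] v(1) by (auto simp: norm_eq_1)
  have "0 \<le> v \<bullet> (sum u ({1..n} - {i}) - x i)"
    using bspec[OF u_nonneg i] h_pos[OF i v(1)] by (simp add: v(2) zero_le_mult_iff)
  moreover have "sum u {1..n} - x i = u i + (sum u ({1..n} - {i}) - x i)"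
    using sum.remove[of "{1..n}" i u] i by simp
  \<comment> \<open>As \<open>v\<close> is a unit vector, the summand \<open>u i\<close> alone
    contributes exactly \<open>support_fun (K i) v\<close>, and the rest is nonnegative; interior
    points of \<open>K i\<close> stay strictly below this value.\<close>
  ultimately have "support_fun (K i) v \<le> v \<bullet> (sum u {1..n} - x i)"
    using \<open>v \<bullet> v = 1\<close> by (simp only: v(2) inner_add_right inner_scaleR_right)
  with less_h[OF i v(1) int] show False
    by (simp add: inner_commute)
qed

end
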